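(* Fix $a>b>0$. For each $n$ (with $n^{3/2}>a$) suppose that the diffusion-scaled ranked queue-length vector at time $0$, $(X^n_{(1)}(0)/\sqrt n,\ldots,X^n_{(n)}(0)/\sqrt n)$, has distribution $\tilde\pi^{(n)}_{(a,b)}$. Then: (i) For any fixed $k\in\mathbb{N}$, the $k$-th ranked queue satisfies $$\frac{\mathbb{E}[X^n_{(k)}(0)]}{\sqrt n\left(\frac1{a-b}+\frac{k-1}{a}\right)}\to1\quad\text{as } n\to\infty.$$ (ii) The system imbalance satisfies $$\frac{\mathbb{E}[X^n_{(n)}(0)-X^n_{(1)}(0)]}{n^{3/2}a^{-1}\log n}\to1\quad\text{as } n\to\infty.$$ (iii) The average queue length satisfies $$\frac{\mathbb{E}\left[\frac1n\sum_{k=1}^nX^n_{(k)}(0)\right]}{n^{3/2}a^{-1}}\to1\quad\text{as } n\to\infty.$$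
   Context: $\mathbb{N}_0=\{0,1,2,\ldots\}$ and $\mathbb{N}_0/\sqrt n=\{m/\sqrt n:m\in\mathbb{N}_0\}$. $X^n_{(k)}(0)$ is the length at time $0$ of the $k$-th shortest among $n$ queues. $\pi^{(n)}_{(a,b)}$ is the probability measure on $(\mathbb{N}_0/\sqrt n)^n$ determined by $$\pi^{(n)}_{(a,b)}([z_1,\infty)\times\cdots\times[z_n,\infty))=\prod_{i=1}^n\big(\rho^{(n)}_i\big)^{\sqrt nz_i},\quad z_i\in\mathbb{N}_0/\sqrt n,\qquad \rho^{(n)}_i=\prod_{j=i}^n\Big(1-\frac a{n^{3/2}}+\frac b{\sqrt n}\mathbf{1}_{\{j=1\}}\Big).$$ $\tilde\pi^{(n)}_{(a,b)}$ is the law of $(z_1,z_1+z_2,\ldots,z_1+\cdots+z_n)$ when $(z_1,\ldots,z_n)\sim\pi^{(n)}_{(a,b)}$. *)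

theory Defs
  imports "HOL-Probability.Probability"
begin

definition scaled_lattice :: "nat \<Rightarrow> real set" where
  "scaled_lattice n = {real m / sqrt (real n) | m. True}"

text \<open>Vectors are extensional functions on \<open>{1..n}\<close>. As \<open>scaled_lattice n\<close> is countable, the product
  \<open>\<sigma>\<close>-algebra contains every subset of \<open>(scaled_lattice n)\<^sup>n\<close>.\<close>

definition lattice_vectors :: "nat \<Rightarrow> (nat \<Rightarrow> real) measure" where
  "lattice_vectors n = (\<Pi>\<^sub>M i\<in>{1..n}. count_space (scaled_lattice n))"

definition rho :: "real \<Rightarrow> real \<Rightarrow> nat \<Rightarrow> nat \<Rightarrow> real" where
  "rho a b n i =
     (\<Prod>j=i..n. 1 - a / real n powr (3/2) + b / sqrt (real n) * indicator {1} j)"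

definition has_gap_tails :: "real \<Rightarrow> real \<Rightarrow> nat \<Rightarrow> (nat \<Rightarrow> real) measure \<Rightarrow> bool" where
  "has_gap_tails a b n P \<longleftrightarrow>
     prob_space P \<and> sets P = sets (lattice_vectors n) \<and>
     (\<forall>z \<in> {1..n} \<rightarrow> scaled_lattice n.
        measure P {x \<in> space P. \<forall>i\<in>{1..n}. z i \<le> x i}
          = (\<Prod>i=1..n. rho a b n i powr (sqrt (real n) * z i)))"

text \<open>Existence and uniqueness for \<open>0 < b < a < n\<^sup>3\<^sup>/\<^sup>2\<close> are \<open>ex1_has_gap_tails\<close> below.\<close>

definition gap_law :: "real \<Rightarrow> real \<Rightarrow> nat \<Rightarrow> (nat \<Rightarrow> real) measure" where
  "gap_law a b n = (THE P. has_gap_tails a b n P)"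

definition ranked_law :: "real \<Rightarrow> real \<Rightarrow> nat \<Rightarrow> (nat \<Rightarrow> real) measure" where
  "ranked_law a b n =
     distr (gap_law a b n) (lattice_vectors n) (\<lambda>z. \<lambda>k\<in>{1..n}. \<Sum>i=1..k. z i)"

text \<open>For \<open>k \<in> {1..n}\<close>, the \<open>k\<close>-th shortest (with multiplicity) of the lengths \<open>q 1, \<dots>, q n\<close>.\<close>

definition ranked :: "nat \<Rightarrow> (nat \<Rightarrow> nat) \<Rightarrow> nat \<Rightarrow> nat" where
  "ranked n q k = sort (map q [1..<Suc n]) ! (k - 1)"

lemma rho_bounds:
  assumes "0 < b" "b < a" "a < real n powr (3/2)" "i \<in> {1..n}"
  shows "0 < rho a b n i" "rho a b n i < 1"
proof -
  define \<alpha> where "\<alpha> = a / real n powr (3/2)"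
  define \<beta> where "\<beta> = b / sqrt (real n)"
  have n: "real n > 0" using assms by auto
  have n32: "real n powr (3/2) = real n * sqrt (real n)"
    using n by (simp add: powr_half_sqrt[symmetric] powr_mult_base)
  have \<alpha>: "0 < \<alpha>" "\<alpha> < 1" using assms n by (auto simp: \<alpha>_def)
  have \<beta>: "0 < \<beta>" using assms n by (auto simp: \<beta>_def)
  have \<alpha>\<beta>: "\<beta> < real n * \<alpha>"
    using assms n by (simp add: \<alpha>_def \<beta>_def n32 field_simps)
  have rho: "rho a b n i = (\<Prod>j=i..n. 1 - \<alpha> + \<beta> * indicator {1} j)"
    by (simp add: rho_def \<alpha>_def \<beta>_def)
  show "0 < rho a b n i"
    unfolding rho using \<alpha> \<beta> by (intro prod_pos) (auto simp: indicator_def)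
  have "rho a b n i \<le> (\<Prod>j=i..n. exp (- \<alpha> + \<beta> * indicator {1} j))"
    unfolding rho
  proof (intro prod_mono conjI)
    fix j
    show "0 \<le> 1 - \<alpha> + \<beta> * indicator {1} j"
      using \<alpha> \<beta> by (auto simp: indicator_def)
    show "1 - \<alpha> + \<beta> * indicator {1} j \<le> exp (- \<alpha> + \<beta> * indicator {1} j)"
      using exp_ge_add_one_self[of "- \<alpha> + \<beta> * indicator {1} j"] by linarith
  qed
  also have "\<dots> = exp (\<Sum>j=i..n. - \<alpha> + \<beta> * indicator {1} j)"
    by (simp add: exp_sum)
  also have "(\<Sum>j=i..n. - \<alpha> + \<beta> * indicator {1} j)
      = - (real (Suc n - i) * \<alpha>) + \<beta> * (\<Sum>j=i..n. indicator {1} j)"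
    by (simp add: sum.distrib sum_distrib_left sum_negf sum_subtractf)
  also have "(\<Sum>j=i..n. indicator {1} j :: real) = (if i = 1 then 1 else 0)"
    using assms by (auto simp: indicator_def sum.delta)
  also have "- (real (Suc n - i) * \<alpha>) + \<beta> * (if i = 1 then 1 else 0) < 0"
    using assms \<alpha> \<alpha>\<beta> by auto
  finally show "rho a b n i < 1" by simp
qed

lemma geometric_tail:
  assumes "0 < r" "r < 1"
  shows "measure (geometric_pmf (1 - r)) {m..} = r ^ m"
proof -
  have p: "1 - r \<in> {0<..1}" using assms by auto
  have "measure (geometric_pmf (1 - r)) {m..} = 1 - measure (geometric_pmf (1 - r)) {..<m}"
    by (subst measure_pmf.prob_compl[symmetric]) (auto intro!: arg_cong[where f="measure _"])
  also have "measure (geometric_pmf (1 - r)) {..<m} = (\<Sum>k<m. r ^ k * (1 - r))"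
    using p by (simp add: measure_measure_pmf_finite)
  also have "\<dots> = 1 - r ^ m"
    by (induction m) (auto simp: algebra_simps)
  finally show ?thesis by simp
qed

lemma ex_has_gap_tails:
  assumes "0 < b" "b < a" "a < real n powr (3/2)"
  shows "\<exists>P. has_gap_tails a b n P"
proof -
  have n: "real n > 0" using assms by (cases "n = 0") auto
  define G where "G i = geometric_pmf (1 - rho a b n i)" for i
  define D where "D i = distr (measure_pmf (G i)) (count_space (scaled_lattice n))
                          (\<lambda>m. real m / sqrt (real n))" for i
  have meas: "(\<lambda>m. real m / sqrt (real n)) \<in> measurable (measure_pmf (G i)) (count_space (scaled_lattice n))" for i
    by (auto simp: scaled_lattice_def)
  have D: "prob_space (D i)" for i
    unfolding D_def by (intro measure_pmf.prob_space_distr meas)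
  interpret finite_product_prob_space D "{1..n}"
    using D by (auto simp: finite_product_prob_space_def finite_product_sigma_finite_def
      finite_product_sigma_finite_axioms_def product_prob_space_def
      product_prob_space_axioms_def product_sigma_finite_def prob_space_imp_sigma_finite)
  let ?P = "PiM {1..n} D"
  have s: "sets ?P = sets (lattice_vectors n)"
    unfolding lattice_vectors_def by (intro sets_PiM_cong) (auto simp: D_def)
  have sp: "space ?P = ({1..n} \<rightarrow>\<^sub>E scaled_lattice n)"
    by (simp add: space_PiM D_def)
  have "measure ?P {x \<in> space ?P. \<forall>i\<in>{1..n}. z i \<le> x i}
          = (\<Prod>i=1..n. rho a b n i powr (sqrt (real n) * z i))"
    if z: "z \<in> {1..n} \<rightarrow> scaled_lattice n" for z
  proof -
    have "{x \<in> space ?P. \<forall>i\<in>{1..n}. z i \<le> x i} = PiE {1..n} (\<lambda>i. {z i..} \<inter> scaled_lattice n)"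
      unfolding sp by (auto simp: PiE_iff extensional_def)
    also have "measure ?P \<dots> = (\<Prod>i=1..n. measure (D i) ({z i..} \<inter> scaled_lattice n))"
      by (intro finite_measure_PiM_emb) (auto simp: D_def)
    also have "\<dots> = (\<Prod>i=1..n. rho a b n i powr (sqrt (real n) * z i))"
    proof (intro prod.cong refl)
      fix i assume i: "i \<in> {1..n}"
      then have "z i \<in> scaled_lattice n" using z by auto
      then obtain m where m: "z i = real m / sqrt (real n)"
        unfolding scaled_lattice_def by blast
      have "measure (D i) ({z i..} \<inter> scaled_lattice n) = measure (G i) {m..}"
        unfolding D_def using n
        by (subst measure_distr[OF meas])
           (auto intro!: arg_cong[where f="measure _"] simp: m divide_le_cancel scaled_lattice_def)
      also have "\<dots> = rho a b n i ^ m"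
        unfolding G_def using rho_bounds[OF assms i] by (rule geometric_tail)
      also have "\<dots> = rho a b n i powr (sqrt (real n) * z i)"
        using rho_bounds[OF assms i] n by (simp add: m powr_realpow)
      finally show "measure (D i) ({z i..} \<inter> scaled_lattice n) = rho a b n i powr (sqrt (real n) * z i)" .
    qed
    finally show ?thesis .
  qed
  then show ?thesis
    unfolding has_gap_tails_def using s prob_space_axioms by blast
qed

lemma lattice_tails_generate:
  assumes "n > 0"
  shows "sets (count_space (scaled_lattice n)) = sigma_sets (scaled_lattice n) ((\<lambda>z. {z..} \<inter> scaled_lattice n) ` scaled_lattice n)"
    (is "_ = sigma_sets ?L ?E")
proof -
  interpret sigma_algebra ?L "sigma_sets ?L ?E"
    by (rule sigma_algebra_sigma_sets) auto
  have c: "countable ?L"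
    unfolding scaled_lattice_def by (simp add: full_SetCompr_eq)
  have single: "{x} \<in> sigma_sets ?L ?E" if x: "x \<in> ?L" for x
  proof -
    obtain m where m: "x = real m / sqrt (real n)" using x by (auto simp: scaled_lattice_def)
    define y where "y = real (Suc m) / sqrt (real n)"
    have y: "y \<in> ?L" unfolding y_def scaled_lattice_def by blast
    have "{x} = ({x..} \<inter> ?L) - ({y..} \<inter> ?L)"
      using assms x by (auto simp: m y_def scaled_lattice_def divide_le_cancel divide_less_cancel not_le)
    also have "\<dots> \<in> sigma_sets ?L ?E"
      using x y by (intro Diff sigma_sets.Basic imageI)
    finally show ?thesis .
  qed
  have "A \<in> sigma_sets ?L ?E" if "A \<subseteq> ?L" for A
  proof -
    have "(\<Union>x\<in>A. {x}) \<in> sigma_sets ?L ?E"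
    proof (rule countable_UN')
      show "countable A" using that c by (rule countable_subset)
      show "(\<lambda>x. {x}) ` A \<subseteq> sigma_sets ?L ?E" using single that by blast
    qed
    then show ?thesis by (simp only: UN_singleton)
  qed
  moreover have "sigma_sets ?L ?E \<subseteq> Pow ?L"
    by (rule space_closed)
  ultimately have "Pow ?L = sigma_sets ?L ?E" by blast
  then show ?thesis by (simp only: sets_count_space)
qed

lemma lattice_vectors_sets:
  assumes "n > 0"
  shows "sets (lattice_vectors n) = sigma_sets ({1..n} \<rightarrow>\<^sub>E scaled_lattice n)
    ((\<lambda>z. {x \<in> {1..n} \<rightarrow>\<^sub>E scaled_lattice n. \<forall>i\<in>{1..n}. z i \<le> x i}) ` ({1..n} \<rightarrow> scaled_lattice n))"
proof -
  let ?L = "scaled_lattice n"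
  let ?E = "(\<lambda>z. {z..} \<inter> ?L) ` ?L"
  let ?S = "{1..n} \<rightarrow>\<^sub>E ?L"
  have zero: "0 \<in> ?L" by (auto simp: scaled_lattice_def)
  have full: "{0..} \<inter> ?L = ?L" by (auto simp: scaled_lattice_def)
  have "sets (lattice_vectors n) = sets (\<Pi>\<^sub>M i\<in>{1..n}. sigma ?L ?E)"
    unfolding lattice_vectors_def
    using lattice_tails_generate[OF assms]
    by (intro sets_PiM_cong refl) (subst sets_measure_of, auto)
  also have "\<dots> = sets (sigma ?S {{f\<in>?S. \<forall>i\<in>j. f i \<in> A i} | A j. j \<in> {{1..n}} \<and> A \<in> Pi j (\<lambda>_. ?E)})"
  proof (rule sets_PiM_sigma)
    show "\<exists>S\<subseteq>?E. countable S \<and> ?L = \<Union>S" for i :: nat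
      using zero full by (intro exI[of _ "{?L}"]) (auto simp: image_iff intro!: bexI[of _ 0])
  qed auto
  also have "{{f\<in>?S. \<forall>i\<in>j. f i \<in> A i} | A j. j \<in> {{1..n}} \<and> A \<in> Pi j (\<lambda>_. ?E)}
      = (\<lambda>z. {x \<in> ?S. \<forall>i\<in>{1..n}. z i \<le> x i}) ` ({1..n} \<rightarrow> ?L)" (is "?A = ?B")
  proof (intro equalityI subsetI)
    fix X assume "X \<in> ?A"
    then obtain A where A: "X = {f\<in>?S. \<forall>i\<in>{1..n}. f i \<in> A i}" "A \<in> Pi {1..n} (\<lambda>_. ?E)"
      by blast
    have "\<exists>y\<in>?L. A i = {y..} \<inter> ?L" if "i \<in> {1..n}" for i
      using Pi_mem[OF A(2) that] by (rule imageE) (rule bexI)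
    then obtain z where z: "\<And>i. i \<in> {1..n} \<Longrightarrow> z i \<in> ?L"
      "\<And>i. i \<in> {1..n} \<Longrightarrow> A i = {z i..} \<inter> ?L" by metis
    have "X = {x \<in> ?S. \<forall>i\<in>{1..n}. z i \<le> x i}"
      unfolding A(1) using z(2) by (intro Collect_cong conj_cong ball_cong refl) (auto simp: PiE_iff)
    moreover have "z \<in> {1..n} \<rightarrow> ?L" using z(1) by (rule Pi_I)
    ultimately show "X \<in> ?B" by (rule image_eqI)
  next
    fix X assume "X \<in> ?B"
    then obtain z where z: "z \<in> {1..n} \<rightarrow> ?L" "X = {x \<in> ?S. \<forall>i\<in>{1..n}. z i \<le> x i}" by blast
    have "X = {f\<in>?S. \<forall>i\<in>{1..n}. f i \<in> {z i..} \<inter> ?L}"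
      unfolding z(2) by (intro Collect_cong conj_cong ball_cong refl) (auto simp: PiE_iff)
    moreover have "(\<lambda>i. {z i..} \<inter> ?L) \<in> Pi {1..n} (\<lambda>_. ?E)"
      using Pi_mem[OF z(1)] by (intro Pi_I imageI)
    ultimately show "X \<in> ?A"
      unfolding mem_Collect_eq
      by (intro exI[of _ "\<lambda>i. {z i..} \<inter> ?L"] exI[of _ "{1..n}"] conjI singletonI)
  qed
  finally show ?thesis
    by (subst (asm) sets_measure_of) auto
qed

lemma has_gap_tails_unique:
  assumes "n > 0" "has_gap_tails a b n P" "has_gap_tails a b n Q"
  shows "P = Q"
proof -
  let ?L = "scaled_lattice n"
  let ?S = "{1..n} \<rightarrow>\<^sub>E ?L"
  let ?C = "\<lambda>z. {x \<in> ?S. \<forall>i\<in>{1..n}. z i \<le> x i}"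
  interpret P: prob_space P using assms by (simp add: has_gap_tails_def)
  interpret Q: prob_space Q using assms by (simp add: has_gap_tails_def)
  have sets: "sets P = sets (lattice_vectors n)" "sets Q = sets (lattice_vectors n)"
    using assms by (auto simp: has_gap_tails_def)
  have "space (lattice_vectors n) = ?S" by (simp add: lattice_vectors_def space_PiM)
  then have space: "space P = ?S" "space Q = ?S"
    using sets[THEN sets_eq_imp_space_eq] by auto
  show ?thesis
  proof (rule measure_eqI_generator_eq[where A="\<lambda>_. ?S"])
    show "Int_stable (?C ` ({1..n} \<rightarrow> ?L))"
    proof (rule Int_stableI_image)
      fix y z assume yz: "y \<in> {1..n} \<rightarrow> ?L" "z \<in> {1..n} \<rightarrow> ?L"
      show "\<exists>w\<in>{1..n} \<rightarrow> ?L. ?C y \<inter> ?C z = ?C w"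
      proof (rule bexI)
        show "?C y \<inter> ?C z = ?C (\<lambda>i. max (y i) (z i))" by auto
        show "(\<lambda>i. max (y i) (z i)) \<in> {1..n} \<rightarrow> ?L"
          using Pi_mem[OF yz(1)] Pi_mem[OF yz(2)] by (intro Pi_I) (simp add: max_def)
      qed
    qed
    show "?C ` ({1..n} \<rightarrow> ?L) \<subseteq> Pow ?S" by auto
    show "sets P = sigma_sets ?S (?C ` ({1..n} \<rightarrow> ?L))" "sets Q = sigma_sets ?S (?C ` ({1..n} \<rightarrow> ?L))"
      using sets lattice_vectors_sets[OF assms(1)] by auto
    show "emeasure P X = emeasure Q X" if "X \<in> ?C ` ({1..n} \<rightarrow> ?L)" for X
    proof -
      obtain z where z: "z \<in> {1..n} \<rightarrow> ?L" "X = ?C z" using \<open>X \<in> _\<close> by blast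
      have "measure P X = measure Q X"
        using assms z unfolding has_gap_tails_def space by simp
      then show ?thesis by (simp add: P.emeasure_eq_measure Q.emeasure_eq_measure)
    qed
    have "0 \<le> y" if "y \<in> ?L" for y using that by (auto simp: scaled_lattice_def)
    then have "?S = ?C (\<lambda>_. 0)" by (auto simp: PiE_iff extensional_def)
    moreover have "(\<lambda>_. 0) \<in> {1..n} \<rightarrow> ?L" by (auto simp: scaled_lattice_def)
    ultimately have "?S \<in> ?C ` ({1..n} \<rightarrow> ?L)" by (rule image_eqI)
    then show "range (\<lambda>_::nat. ?S) \<subseteq> ?C ` ({1..n} \<rightarrow> ?L)" by (intro image_subsetI)
  qed auto
qed

lemma ex1_has_gap_tails:
  assumes "0 < b" "b < a" "a < real n powr (3/2)"
  shows "\<exists>!P. has_gap_tails a b n P"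
proof -
  have "n > 0" using assms by (cases "n = 0") auto
  then show ?thesis using ex_has_gap_tails[OF assms] has_gap_tails_unique by blast
qed

end

theory Submission
  imports Defs "HOL-Real_Asymp.Real_Asymp"
begin

text \<open>
  Under the gap law, \<open>\<surd>n\<close> times the \<open>i\<close>-th gap is geometric with success probability
  \<open>1 - \<rho>\<^sub>i\<close>, so its mean is \<open>g\<^sub>i = \<rho>\<^sub>i / (1 - \<rho>\<^sub>i)\<close> (lemma \<open>gap_expectation\<close>). The \<open>k\<close>-th
  ranked queue is the sum of the first \<open>k\<close> gaps, hence by linearity its mean is
  \<open>g\<^sub>1 + \<dots> + g\<^sub>k\<close> (lemma \<open>ranked_expectation\<close>). What
  remains is the asymptotics of the numbers \<open>g\<^sub>i\<close>.

  For \<open>i \<ge> 2\<close> we have \<open>\<rho>\<^sub>i = (1 - \<alpha>)\<^sup>m\<close> with \<open>\<alpha> = a / n\<^sup>3\<^sup>/\<^sup>2\<close> and \<open>m = n + 1 - i\<close>.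
  Bernoulli's inequality, applied to \<open>(1 - \<alpha>)\<^sup>m\<close> and to \<open>(1 + \<alpha>)\<^sup>m\<close>, then gives
  \<open>1 / (m \<alpha>) - 1 \<le> g\<^sub>i \<le> 1 / (m \<alpha>)\<close>
  (lemma \<open>mean_gap_bounds\<close>). This one estimate, uniform in \<open>i\<close>, handles every gap but the first in
  all three claims, because the error \<open>1\<close> per gap is negligible on each scale:

  \<^item> For fixed \<open>i \<ge> 2\<close> it gives \<open>g\<^sub>i / \<surd>n \<longlonglongrightarrow> 1 / a\<close>. The first gap is the only one that feels \<open>b\<close>,
    and there \<open>\<surd>n (1 - \<rho>\<^sub>1) \<longlonglongrightarrow> a - b\<close>.
  \<^item> The imbalance has mean \<open>g\<^sub>2 + \<dots> + g\<^sub>n\<close>, which lies within \<open>n\<close> of a harmonic number divided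
    by \<open>\<alpha>\<close>. This is the source of the factor \<open>ln n\<close>.
  \<^item> In the sum of all queue lengths the gap \<open>i\<close> is counted \<open>n + 1 - i = m\<close> times, which cancels
    the \<open>m\<close> in the estimate: every gap but the first contributes \<open>1 / \<alpha>\<close>, up to an error of at most \<open>n\<close>.
\<close>

section \<open>Expectations of the gaps\<close>

text \<open>The mean of a variable with values in the naturals is the sum of its tail probabilities, here a
  geometric series.\<close>

lemma (in prob_space) geometric_tails_imp_expectation:
  fixes N :: "'a \<Rightarrow> nat"
  assumes N: "N \<in> measurable M (count_space UNIV)"
    and r: "0 \<le> r" "r < 1"
    and tail: "\<And>m. prob {x \<in> space M. m \<le> N x} = r ^ m"
  shows "has_bochner_integral M (\<lambda>x. real (N x)) (r / (1 - r))"
proof (rule has_bochner_integral_nn_integral)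
  have "(\<integral>\<^sup>+x. ennreal (real (N x)) \<partial>M) = (\<Sum>t. emeasure M {x \<in> space M. t < N x})"
    using nn_integral_nat_function[OF N] by (simp add: ennreal_of_nat_eq_real_of_nat)
  also have "\<dots> = (\<Sum>t. ennreal (r ^ Suc t))"
    unfolding tail[symmetric] by (simp add: emeasure_eq_measure Suc_le_eq)
  also have "\<dots> = ennreal (r / (1 - r))"
  proof (rule suminf_ennreal_eq)
    show "0 \<le> r ^ Suc t" for t using r by simp
    show "(\<lambda>t. r ^ Suc t) sums (r / (1 - r))"
      using sums_mult[OF geometric_sums[of r], of r] r by simp
  qed
  finally show "(\<integral>\<^sup>+x. ennreal (real (N x)) \<partial>M) = ennreal (r / (1 - r))" .
  show "(\<lambda>x. real (N x)) \<in> borel_measurable M"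
    using N by measurable
qed (use r in auto)

definition mean_gap :: "real \<Rightarrow> real \<Rightarrow> nat \<Rightarrow> nat \<Rightarrow> real" where
  "mean_gap a b n i = rho a b n i / (1 - rho a b n i)"

lemma has_gap_tails_gap_law:
  assumes "0 < b" "b < a" "a < real n powr (3/2)"
  shows "has_gap_tails a b n (gap_law a b n)"
  unfolding gap_law_def using ex1_has_gap_tails[OF assms] by (rule theI')

lemma space_lattice_vectors: "space (lattice_vectors n) = {1..n} \<rightarrow>\<^sub>E scaled_lattice n"
  by (simp add: lattice_vectors_def space_PiM)

lemma borel_measurable_lattice_coordinate:
  assumes "i \<in> {1..n}"
  shows "(\<lambda>x. x i) \<in> borel_measurable (lattice_vectors n)"
proof -
  have "(\<lambda>x. x i) \<in> measurable (lattice_vectors n) (count_space (scaled_lattice n))"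
    unfolding lattice_vectors_def using assms by (rule measurable_component_singleton)
  then show ?thesis
    by (rule measurable_compose) simp
qed

text \<open>The joint tails determine the marginal ones: a threshold \<open>0\<close> imposes no condition on a
  coordinate and contributes the factor \<open>\<rho>\<^sub>j powr 0 = 1\<close>.\<close>

lemma gap_marginal_tail:
  assumes ab: "0 < b" "b < a" "a < real n powr (3/2)" and i: "i \<in> {1..n}"
  shows "measure (gap_law a b n) {x \<in> space (gap_law a b n). real m / sqrt (real n) \<le> x i}
           = rho a b n i ^ m"
proof -
  let ?P = "gap_law a b n"
  define z where "z j = (if j = i then real m / sqrt (real n) else 0)" for j
  have n: "real n > 0" using i by auto
  note tails = has_gap_tails_gap_law[OF ab]
  have sp: "space ?P = {1..n} \<rightarrow>\<^sub>E scaled_lattice n"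
    using tails sets_eq_imp_space_eq space_lattice_vectors unfolding has_gap_tails_def by blast
  have z: "z \<in> {1..n} \<rightarrow> scaled_lattice n"
    unfolding z_def scaled_lattice_def by (auto intro: exI[of _ "0::nat"])
  have "0 \<le> x j" if "x \<in> space ?P" "j \<in> {1..n}" for x j
    using that unfolding sp PiE_iff scaled_lattice_def by fastforce
  then have "{x \<in> space ?P. real m / sqrt (real n) \<le> x i} = {x \<in> space ?P. \<forall>j\<in>{1..n}. z j \<le> x j}"
    using i by (auto simp: z_def)
  then have "measure ?P {x \<in> space ?P. real m / sqrt (real n) \<le> x i}
      = (\<Prod>j=1..n. rho a b n j powr (sqrt (real n) * z j))"
    using tails z unfolding has_gap_tails_def by auto
  also have "\<dots> = (\<Prod>j=1..n. if j = i then rho a b n i ^ m else 1)"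
    using rho_bounds[OF ab] n
    by (intro prod.cong refl) (auto simp: z_def powr_realpow less_imp_neq[symmetric])
  also have "\<dots> = rho a b n i ^ m"
    using i by (simp add: prod.delta)
  finally show ?thesis .
qed

lemma gap_expectation:
  assumes ab: "0 < b" "b < a" "a < real n powr (3/2)" and i: "i \<in> {1..n}"
  shows "has_bochner_integral (gap_law a b n) (\<lambda>z. z i) (mean_gap a b n i / sqrt (real n))"
proof -
  let ?P = "gap_law a b n"
  have n: "real n > 0" using i by auto
  note tails = has_gap_tails_gap_law[OF ab]
  interpret prob_space ?P using tails by (simp add: has_gap_tails_def)
  have sets: "sets ?P = sets (lattice_vectors n)"
    using tails by (simp add: has_gap_tails_def)
  have sp: "space ?P = {1..n} \<rightarrow>\<^sub>E scaled_lattice n"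
    using sets_eq_imp_space_eq[OF sets] space_lattice_vectors by simp
  have meas: "(\<lambda>z. z i) \<in> borel_measurable ?P"
    using borel_measurable_lattice_coordinate[OF i] measurable_cong_sets[OF sets refl] by blast
  define N where "N z = nat \<lfloor>sqrt (real n) * z i\<rfloor>" for z :: "nat \<Rightarrow> real"
  have N: "z i = real (N z) / sqrt (real n)" if "z \<in> space ?P" for z
  proof -
    have "z i \<in> scaled_lattice n" using that i unfolding sp by auto
    then obtain m where "z i = real m / sqrt (real n)" by (auto simp: scaled_lattice_def)
    with n show ?thesis by (simp add: N_def)
  qed
  have "has_bochner_integral ?P (\<lambda>z. real (N z)) (mean_gap a b n i)"
    unfolding mean_gap_def
  proof (rule geometric_tails_imp_expectation)
    show "N \<in> measurable ?P (count_space UNIV)"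
      unfolding N_def using meas by measurable
    show "0 \<le> rho a b n i" "rho a b n i < 1"
      using rho_bounds[OF ab i] by auto
    fix m
    have "{x \<in> space ?P. m \<le> N x} = {x \<in> space ?P. real m / sqrt (real n) \<le> x i}"
      using n by (auto simp: N divide_le_cancel)
    then show "prob {x \<in> space ?P. m \<le> N x} = rho a b n i ^ m"
      using gap_marginal_tail[OF ab i] by simp
  qed
  then have "has_bochner_integral ?P (\<lambda>z. real (N z) / sqrt (real n)) (mean_gap a b n i / sqrt (real n))"
    by (rule has_bochner_integral_divide_zero)
  then show ?thesis
    by (rule has_bochner_integral_cong[THEN iffD1, rotated -1]) (auto simp: N)
qed

section \<open>Expectations of the ranked queue lengths\<close>

lemma measurable_partial_sums_lattice:
  assumes "n > 0"
  shows "(\<lambda>z. \<lambda>k\<in>{1..n}. \<Sum>i=1..k. z i) \<in> measurable (lattice_vectors n) (lattice_vectors n)"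
  unfolding lattice_vectors_def
proof (rule measurable_restrict)
  let ?L = "scaled_lattice n"
  let ?M = "PiM {1..n} (\<lambda>_. count_space ?L)"
  fix k assume k: "k \<in> {1..n}"
  have count: "countable ?L"
    unfolding scaled_lattice_def by (simp add: full_SetCompr_eq)
  have in_lattice: "(\<Sum>i=1..k. z i) \<in> ?L" if z: "z \<in> space ?M" for z
  proof -
    have "\<exists>m. z i = real m / sqrt (real n)" if "i \<in> {1..k}" for i
      using z k that by (auto simp: space_PiM PiE_iff scaled_lattice_def)
    then obtain m where m: "\<And>i. i \<in> {1..k} \<Longrightarrow> z i = real (m i) / sqrt (real n)" by metis
    have "(\<Sum>i=1..k. z i) = real (\<Sum>i=1..k. m i) / sqrt (real n)"
      by (simp add: m sum_divide_distrib)
    then show ?thesis unfolding scaled_lattice_def by blast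
  qed
  \<comment> \<open>On a countable target, measurability into the reals suffices, since singletons are Borel.\<close>
  have "(\<lambda>z. \<Sum>i=1..k. z i) \<in> borel_measurable ?M"
    using k borel_measurable_lattice_coordinate[of _ n]
    by (intro borel_measurable_sum) (auto simp: lattice_vectors_def)
  then show "(\<lambda>z. \<Sum>i=1..k. z i) \<in> measurable ?M (count_space ?L)"
    using in_lattice count
    by (subst measurable_count_space_eq_countable) (auto intro: measurable_sets)
qed

lemma ranked_law_expectation:
  assumes ab: "0 < b" "b < a" "a < real n powr (3/2)" and k: "k \<in> {1..n}"
  shows "has_bochner_integral (ranked_law a b n) (\<lambda>x. x k)
           ((\<Sum>i=1..k. mean_gap a b n i) / sqrt (real n))"
proof -
  have sets: "sets (gap_law a b n) = sets (lattice_vectors n)"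
    using has_gap_tails_gap_law[OF ab] by (simp add: has_gap_tails_def)
  have "(\<lambda>z. \<lambda>k\<in>{1..n}. \<Sum>i=1..k. z i) \<in> measurable (gap_law a b n) (lattice_vectors n)"
    using measurable_partial_sums_lattice[of n] k measurable_cong_sets[OF sets refl] by auto
  moreover have "has_bochner_integral (gap_law a b n) (\<lambda>z. \<Sum>i=1..k. z i)
      (\<Sum>i=1..k. mean_gap a b n i / sqrt (real n))"
    using k by (intro has_bochner_integral_sum gap_expectation[OF ab]) auto
  ultimately show ?thesis
    unfolding ranked_law_def has_bochner_integral_iff
    using k borel_measurable_lattice_coordinate[OF k]
    by (simp add: integrable_distr_eq integral_distr sum_divide_distrib)
qed

text \<open>The list of queue lengths ranges over a countable type, so it is measurable for the discrete
  \<open>\<sigma>\<close>-algebra, and every function of it is then measurable too.\<close>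

lemma measurable_ranked:
  fixes Q :: "nat \<Rightarrow> 'w \<Rightarrow> nat"
  assumes "\<And>i. i \<in> {1..n} \<Longrightarrow> Q i \<in> measurable M (count_space UNIV)"
  shows "(\<lambda>\<omega>. ranked n (\<lambda>i. Q i \<omega>) k) \<in> measurable M (count_space UNIV)"
proof -
  have "(\<lambda>\<omega>. map (\<lambda>i. Q i \<omega>) is) \<in> measurable M (count_space UNIV)"
    if "set is \<subseteq> {1..n}" for "is"
    using that
  proof (induction "is")
    case (Cons i "is")
    then have Q: "Q i \<in> measurable M (count_space UNIV)"
      and tl: "(\<lambda>\<omega>. map (\<lambda>i. Q i \<omega>) is) \<in> measurable M (count_space UNIV)"
      using assms by auto
    have "(\<lambda>\<omega>. m # map (\<lambda>i. Q i \<omega>) is) \<in> measurable M (count_space UNIV)" for m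
      using tl by (rule measurable_compose) simp
    from measurable_compose_countable[OF this Q] show ?case by simp
  qed simp
  then have "(\<lambda>\<omega>. map (\<lambda>i. Q i \<omega>) [1..<Suc n]) \<in> measurable M (count_space UNIV)"
    by (simp add: atLeastLessThanSuc_atLeastAtMost del: upt_Suc)
  then have "(\<lambda>\<omega>. sort (map (\<lambda>i. Q i \<omega>) [1..<Suc n]) ! (k - 1)) \<in> measurable M (count_space UNIV)"
    by (rule measurable_compose[of _ _ _ "\<lambda>qs. sort qs ! (k - 1)"]) simp
  then show ?thesis by (simp only: ranked_def)
qed

text \<open>The law of the whole scaled ranked vector is known, so the mean of its \<open>k\<close>-th coordinate can be
  computed under \<open>ranked_law\<close>; the factor \<open>\<surd>n\<close> of the scaling cancels.\<close>

lemma ranked_expectation: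
  fixes Q :: "nat \<Rightarrow> 'w \<Rightarrow> nat"
  assumes ab: "0 < b" "b < a" "a < real n powr (3/2)" and k: "k \<in> {1..n}"
    and Q: "\<And>i. i \<in> {1..n} \<Longrightarrow> Q i \<in> measurable M (count_space UNIV)"
    and law: "distr M (lattice_vectors n)
             (\<lambda>\<omega>. \<lambda>k\<in>{1..n}. real (ranked n (\<lambda>i. Q i \<omega>) k) / sqrt (real n)) = ranked_law a b n"
  shows "has_bochner_integral M (\<lambda>\<omega>. real (ranked n (\<lambda>i. Q i \<omega>) k)) (\<Sum>i=1..k. mean_gap a b n i)"
proof -
  have n: "real n > 0" using k by auto
  let ?R = "\<lambda>\<omega>. \<lambda>k\<in>{1..n}. real (ranked n (\<lambda>i. Q i \<omega>) k) / sqrt (real n)"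
  have "(\<lambda>\<omega>. real (ranked n (\<lambda>i. Q i \<omega>) k) / sqrt (real n)) \<in> measurable M (count_space (scaled_lattice n))" for k
    by (rule measurable_compose[OF measurable_ranked[OF Q]]) (auto simp: scaled_lattice_def)
  then have "?R \<in> measurable M (lattice_vectors n)"
    unfolding lattice_vectors_def by (intro measurable_restrict)
  then have "has_bochner_integral M (\<lambda>\<omega>. ?R \<omega> k) ((\<Sum>i=1..k. mean_gap a b n i) / sqrt (real n))"
    using ranked_law_expectation[OF ab k] borel_measurable_lattice_coordinate[OF k]
    unfolding law[symmetric] has_bochner_integral_iff
    by (simp add: integrable_distr_eq integral_distr)
  then have "has_bochner_integral M (\<lambda>\<omega>. ?R \<omega> k * sqrt (real n))
      ((\<Sum>i=1..k. mean_gap a b n i) / sqrt (real n) * sqrt (real n))"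
    by (rule has_bochner_integral_mult_left)
  then show ?thesis using n k by simp
qed

section \<open>Asymptotics of the mean gaps\<close>

lemma sum_split_first:
  fixes f :: "nat \<Rightarrow> real"
  assumes "n \<ge> 1"
  shows "(\<Sum>i=1..n. f i) = f 1 + (\<Sum>i=2..n. f i)"
  using sum.atLeast_Suc_atMost[of 1 n f] assms by (simp add: numeral_2_eq_2)

lemma rho_eq_power:
  assumes "2 \<le> i"
  shows "rho a b n i = (1 - a / real n powr (3/2)) ^ (Suc n - i)"
proof -
  have "rho a b n i = (\<Prod>j=i..n. 1 - a / real n powr (3/2))"
    unfolding rho_def using assms by (intro prod.cong) (auto simp: indicator_def)
  then show ?thesis by simp
qed

lemma rho_1:
  assumes "n \<ge> 1"
  shows "rho a b n 1 = (1 - a / real n powr (3/2) + b / sqrt (real n)) * (1 - a / real n powr (3/2)) ^ (n - 1)"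
proof -
  have "rho a b n 1 = (1 - a / real n powr (3/2) + b / sqrt (real n)) * rho a b n 2"
    unfolding rho_def using assms by (subst prod.atLeast_Suc_atMost) (auto simp: numeral_2_eq_2)
  then show ?thesis by (simp add: rho_eq_power)
qed

text \<open>Both bounds are Bernoulli's inequality. The lower one uses \<open>1 - m \<alpha> \<le> (1 - \<alpha>)\<^sup>m\<close>. The upper one
  uses \<open>(1 - \<alpha>)\<^sup>m (1 + m \<alpha>) \<le> ((1 - \<alpha>) (1 + \<alpha>))\<^sup>m \<le> 1\<close>, which avoids any exponential
  estimate.\<close>

lemma geometric_mean_bounds:
  fixes \<alpha> :: real
  assumes \<alpha>: "0 < \<alpha>" "\<alpha> < 1" and m: "m > 0"
  shows "1 / (real m * \<alpha>) - 1 \<le> (1 - \<alpha>) ^ m / (1 - (1 - \<alpha>) ^ m)"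
    and "(1 - \<alpha>) ^ m / (1 - (1 - \<alpha>) ^ m) \<le> 1 / (real m * \<alpha>)"
proof -
  let ?q = "(1 - \<alpha>) ^ m"
  have q: "0 \<le> ?q" "?q < 1"
    using \<alpha> m by (auto simp: power_less_one_iff)
  have low: "1 - real m * \<alpha> \<le> ?q"
    using Bernoulli_inequality[of "-\<alpha>" m] \<alpha> by simp
  have "?q * (1 + real m * \<alpha>) \<le> ?q * (1 + \<alpha>) ^ m"
    using Bernoulli_inequality[of \<alpha> m] \<alpha> q by (intro mult_left_mono) auto
  also have "\<dots> = ((1 - \<alpha>) * (1 + \<alpha>)) ^ m"
    by (simp add: power_mult_distrib)
  also have "\<dots> \<le> 1"
    using \<alpha> by (intro power_le_one) (auto simp: algebra_simps mult_le_one)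
  finally have up: "?q * (1 + real m * \<alpha>) \<le> 1" .
  have "1 / (real m * \<alpha>) \<le> 1 / (1 - ?q)"
    using low q by (intro divide_left_mono) (use \<alpha> m in auto)
  also have "1 / (1 - ?q) = ?q / (1 - ?q) + 1"
    using q by (simp add: field_simps)
  finally show "1 / (real m * \<alpha>) - 1 \<le> ?q / (1 - ?q)" by simp
  show "?q / (1 - ?q) \<le> 1 / (real m * \<alpha>)"
    using up q \<alpha> m by (simp add: field_simps)
qed

lemma mean_gap_bounds:
  assumes a: "0 < a" "a < real n powr (3/2)" and i: "i \<in> {2..n}"
  shows "real n powr (3/2) / a / real (Suc n - i) - 1 \<le> mean_gap a b n i"
    and "mean_gap a b n i \<le> real n powr (3/2) / a / real (Suc n - i)"
proof -
  define \<alpha> where "\<alpha> = a / real n powr (3/2)"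
  have n: "real n powr (3/2) > 0" using a by linarith
  have \<alpha>: "0 < \<alpha>" "\<alpha> < 1" using a n by (auto simp: \<alpha>_def)
  have eq: "real n powr (3/2) / a / real (Suc n - i) = 1 / (real (Suc n - i) * \<alpha>)"
    using a n by (simp add: \<alpha>_def field_simps)
  have gap: "mean_gap a b n i = (1 - \<alpha>) ^ (Suc n - i) / (1 - (1 - \<alpha>) ^ (Suc n - i))"
    using i by (simp add: mean_gap_def rho_eq_power \<alpha>_def)
  have m: "0 < Suc n - i" using i by auto
  show "real n powr (3/2) / a / real (Suc n - i) - 1 \<le> mean_gap a b n i"
    and "mean_gap a b n i \<le> real n powr (3/2) / a / real (Suc n - i)"
    unfolding eq gap using geometric_mean_bounds[OF \<alpha> m] by auto
qed

lemma eventually_less_powr_three_halves: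
  fixes a :: real
  shows "\<forall>\<^sub>F n in sequentially. a < real n powr (3/2)"
  by real_asymp

text \<open>Here \<open>\<rho>\<^sub>1 = 1 - (a - b) / \<surd>n + o(1 / \<surd>n)\<close>: the \<open>n\<close> factors \<open>1 - \<alpha>\<close> together lose \<open>a / \<surd>n\<close>, and
  the single summand \<open>b / \<surd>n\<close> is of the same order.\<close>

lemma mean_gap_first_limit:
  assumes "0 < b" "b < a"
  shows "(\<lambda>n. mean_gap a b n 1 / sqrt (real n)) \<longlonglongrightarrow> 1 / (a - b)"
proof -
  let ?r = "\<lambda>n. (1 - a / real n powr (3/2) + b / sqrt (real n)) * (1 - a / real n powr (3/2)) ^ (n - 1)"
  have r: "?r \<longlonglongrightarrow> 1" using assms by real_asymp
  have "(\<lambda>n. sqrt (real n) * (1 - ?r n)) \<longlonglongrightarrow> a - b" using assms by real_asymp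
  from tendsto_divide[OF r this] have "(\<lambda>n. ?r n / (sqrt (real n) * (1 - ?r n))) \<longlonglongrightarrow> 1 / (a - b)"
    using assms by simp
  moreover have "\<forall>\<^sub>F n in sequentially. ?r n / (sqrt (real n) * (1 - ?r n)) = mean_gap a b n 1 / sqrt (real n)"
    using eventually_ge_at_top[of 1]
    by eventually_elim (simp add: mean_gap_def rho_1 mult.commute del: One_nat_def)
  ultimately show ?thesis by (rule Lim_transform_eventually)
qed

lemma mean_gap_later_limit:
  assumes a: "0 < a" and i: "2 \<le> i"
  shows "(\<lambda>n. mean_gap a b n i / sqrt (real n)) \<longlonglongrightarrow> 1 / a"
  unfolding inverse_eq_divide[symmetric]
proof (rule tendsto_sandwich)
  let ?u = "\<lambda>n. real n powr (3/2) / a / (1 + real n - real i)"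
  show "(\<lambda>n. (?u n - 1) / sqrt (real n)) \<longlonglongrightarrow> inverse a"
    using a by real_asymp
  show "(\<lambda>n. ?u n / sqrt (real n)) \<longlonglongrightarrow> inverse a"
    using a by real_asymp
  have *: "\<forall>\<^sub>F n in sequentially. ?u n - 1 \<le> mean_gap a b n i \<and> mean_gap a b n i \<le> ?u n"
    using eventually_less_powr_three_halves[of a] eventually_ge_at_top[of i]
  proof eventually_elim
    case (elim n)
    then have "real (Suc n - i) = 1 + real n - real i" by (simp add: of_nat_diff)
    then show ?case
      using mean_gap_bounds[OF a elim(1), of i b] i elim(2) by auto
  qed
  show "\<forall>\<^sub>F n in sequentially. (?u n - 1) / sqrt (real n) \<le> mean_gap a b n i / sqrt (real n)"
    using * by (rule eventually_mono) (intro divide_right_mono, auto)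
  show "\<forall>\<^sub>F n in sequentially. mean_gap a b n i / sqrt (real n) \<le> ?u n / sqrt (real n)"
    using * by (rule eventually_mono) (intro divide_right_mono, auto)
qed

lemma harm_asymptotics: "(\<lambda>n. harm (n - 1) / ln (real n)) \<longlonglongrightarrow> (1 :: real)"
proof -
  \<comment> \<open>\<open>harm n - ln n\<close> converges, so it vanishes after division by \<open>ln n\<close>.\<close>
  have "(\<lambda>n. (harm n - ln (real n)) / ln (real n) + (1 - 1 / (real n * ln (real n)))) \<longlonglongrightarrow> (0::real) + 1"
  proof (intro tendsto_add)
    show "(\<lambda>n. (harm n - ln (real n)) / ln (real n)) \<longlonglongrightarrow> (0::real)"
      using euler_mascheroni_LIMSEQ by (rule tendsto_divide_0) real_asymp
    show "(\<lambda>n. 1 - 1 / (real n * ln (real n))) \<longlonglongrightarrow> 1" by real_asymp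
  qed
  moreover have "\<forall>\<^sub>F n in sequentially. (harm n - ln (real n)) / ln (real n)
      + (1 - 1 / (real n * ln (real n))) = harm (n - 1) / ln (real n)"
    using eventually_ge_at_top[of 2]
  proof eventually_elim
    case (elim n)
    then have ln: "ln (real n) \<noteq> 0" by simp
    have "harm n = harm (n - 1) + 1 / real n"
      using harm_Suc[of "n - 1", where ?'a = real] elim by (simp add: inverse_eq_divide)
    then show ?case using ln elim by (simp add: field_simps)
  qed
  ultimately show ?thesis by (simp add: Lim_transform_eventually)
qed

text \<open>With \<open>m = n + 1 - i\<close> the bounds on the gaps sum to \<open>harm (n - 1) / \<alpha>\<close> from above, and to the
  same up to \<open>n\<close> from below; \<open>n\<close> is small compared with \<open>n\<^sup>3\<^sup>/\<^sup>2 ln n\<close>.\<close>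

lemma sum_mean_gap_limit:
  assumes a: "0 < a"
  shows "(\<lambda>n. (\<Sum>i=2..n. mean_gap a b n i) / (real n powr (3/2) * inverse a * ln (real n))) \<longlonglongrightarrow> 1"
proof (rule tendsto_sandwich)
  let ?D = "\<lambda>n. real n powr (3/2) * inverse a * ln (real n)"
  let ?S = "\<lambda>n. \<Sum>i=2..n. mean_gap a b n i"
  have "(\<lambda>n. harm (n - 1) / ln (real n) - real n / ?D n) \<longlonglongrightarrow> 1 - 0"
    by (intro tendsto_diff harm_asymptotics) (use a in real_asymp)
  then show "(\<lambda>n. harm (n - 1) / ln (real n) - real n / ?D n) \<longlonglongrightarrow> 1" by simp
  show "(\<lambda>n. harm (n - 1) / ln (real n)) \<longlonglongrightarrow> (1 :: real)" by (rule harm_asymptotics)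
  have *: "\<forall>\<^sub>F n in sequentially. harm (n - 1) / ln (real n) - real n / ?D n \<le> ?S n / ?D n
      \<and> ?S n / ?D n \<le> harm (n - 1) / ln (real n)"
    using eventually_less_powr_three_halves[of a] eventually_ge_at_top[of 2]
  proof eventually_elim
    case (elim n)
    let ?L = "real n powr (3/2) / a"
    have L: "?L > 0" and ln: "ln (real n) > 0" using a elim by auto
    have D: "?D n = ?L * ln (real n)" by (simp add: field_simps)
    have D0: "?D n > 0" unfolding D using L ln by (rule mult_pos_pos)
    have "(\<Sum>i=2..n. ?L / real (Suc n - i)) = (\<Sum>m=1..n-1. ?L / real m)"
      by (rule sum.reindex_bij_witness[of _ "\<lambda>m. Suc n - m" "\<lambda>i. Suc n - i"]) auto
    also have "\<dots> = ?L * harm (n - 1)"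
      by (simp only: harm_def sum_distrib_left divide_inverse of_nat_id)
    finally have harm: "(\<Sum>i=2..n. ?L / real (Suc n - i)) = ?L * harm (n - 1)" .
    have "?S n \<le> ?L * harm (n - 1)"
      unfolding harm[symmetric] by (intro sum_mono mean_gap_bounds a elim)
    then have "?S n / ?D n \<le> ?L * harm (n - 1) / ?D n"
      using D0 by (intro divide_right_mono) auto
    moreover have "?L * harm (n - 1) - real n \<le> ?S n"
    proof -
      have "?L * harm (n - 1) - real n \<le> (\<Sum>i=2..n. ?L / real (Suc n - i) - 1)"
        unfolding sum_subtractf harm by simp
      also have "\<dots> \<le> ?S n" by (intro sum_mono mean_gap_bounds a elim)
      finally show ?thesis .
    qed
    then have "(?L * harm (n - 1) - real n) / ?D n \<le> ?S n / ?D n"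
      using D0 by (intro divide_right_mono) auto
    moreover have "?L * harm (n - 1) / ?D n = harm (n - 1) / ln (real n)"
      unfolding D using less_imp_neq[OF L] by (intro mult_divide_mult_cancel_left) simp
    ultimately show ?case by (simp add: diff_divide_distrib)
  qed
  show "\<forall>\<^sub>F n in sequentially. harm (n - 1) / ln (real n) - real n / ?D n \<le> ?S n / ?D n"
    using * by (rule eventually_mono) blast
  show "\<forall>\<^sub>F n in sequentially. ?S n / ?D n \<le> harm (n - 1) / ln (real n)"
    using * by (rule eventually_mono) blast
qed

lemma sum_partial_sums:
  fixes f :: "nat \<Rightarrow> real"
  shows "(\<Sum>k=1..n. \<Sum>i=1..k. f i) = (\<Sum>i=1..n. real (Suc n - i) * f i)"
proof (induction n)
  case (Suc n)
  have "(\<Sum>i=1..n. real (Suc (Suc n) - i) * f i) = (\<Sum>i=1..n. real (Suc n - i) * f i + f i)"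
    by (intro sum.cong) (auto simp: Suc_diff_le algebra_simps)
  with Suc show ?case by (simp add: sum.distrib)
qed simp

text \<open>The first gap has mean of order \<open>\<surd>n\<close> and the average needs \<open>n\<^sup>3\<^sup>/\<^sup>2\<close>, so it disappears in the
  limit. Each later gap carries its weight \<open>m = n + 1 - i\<close>, and \<open>m g\<^sub>i\<close> lies between
  \<open>1 / \<alpha> - m\<close> and \<open>1 / \<alpha>\<close>.\<close>

lemma average_mean_gap_limit:
  assumes ab: "0 < b" "b < a"
  shows "(\<lambda>n. (1 / real n) * (\<Sum>k=1..n. \<Sum>i=1..k. mean_gap a b n i)
              / (real n powr (3/2) * inverse a)) \<longlonglongrightarrow> 1"
proof -
  have a: "0 < a" using ab by simp
  let ?L = "\<lambda>n. real n powr (3/2) / a"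
  let ?T = "\<lambda>n. \<Sum>i=2..n. real (Suc n - i) * mean_gap a b n i"
  have T: "(\<lambda>n. ?T n / (real n * ?L n)) \<longlonglongrightarrow> 1"
  proof (rule tendsto_sandwich)
    show "(\<lambda>n. ((real n - 1) * ?L n - real n * real n) / (real n * ?L n)) \<longlonglongrightarrow> 1"
      and "(\<lambda>n. (real n - 1) * ?L n / (real n * ?L n)) \<longlonglongrightarrow> 1"
      using a by real_asymp+
    have *: "\<forall>\<^sub>F n in sequentially. (real n - 1) * ?L n - real n * real n \<le> ?T n \<and> ?T n \<le> (real n - 1) * ?L n"
      using eventually_less_powr_three_halves[of a] eventually_ge_at_top[of 2]
    proof eventually_elim
      case (elim n)
      have "?L n - real n \<le> real (Suc n - i) * mean_gap a b n i \<and> real (Suc n - i) * mean_gap a b n i \<le> ?L n"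
        if i: "i \<in> {2..n}" for i
      proof
        let ?m = "real (Suc n - i)"
        have m: "0 < ?m" "?m \<le> real n" using i by auto
        have cancel: "?m * (?L n / ?m) = ?L n"
          using m(1) by (metis less_irrefl nonzero_mult_div_cancel_left times_divide_eq_right)
        have "?L n - real n \<le> ?m * (?L n / ?m - 1)"
          unfolding right_diff_distrib cancel using m(2) by linarith
        also have "\<dots> \<le> ?m * mean_gap a b n i"
          using mean_gap_bounds[OF a elim(1) i] m by (intro mult_left_mono) auto
        finally show "?L n - real n \<le> ?m * mean_gap a b n i" .
        have "?m * mean_gap a b n i \<le> ?m * (?L n / ?m)"
          using mean_gap_bounds[OF a elim(1) i] m by (intro mult_left_mono) auto
        then show "?m * mean_gap a b n i \<le> ?L n" unfolding cancel .
      qed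
      then have "(\<Sum>i=2..n. ?L n - real n) \<le> ?T n" "?T n \<le> (\<Sum>i=2..n. ?L n)"
        by (blast intro: sum_mono)+
      moreover have "real (Suc n - 2) = real n - 1" using elim by (simp add: of_nat_diff)
      ultimately show ?case by (simp add: algebra_simps)
    qed
    have nonneg: "0 \<le> real n * ?L n" for n
      using a by (intro mult_nonneg_nonneg divide_nonneg_pos) auto
    show "\<forall>\<^sub>F n in sequentially. ((real n - 1) * ?L n - real n * real n) / (real n * ?L n) \<le> ?T n / (real n * ?L n)"
      using * by (rule eventually_mono) (intro divide_right_mono nonneg, blast)
    show "\<forall>\<^sub>F n in sequentially. ?T n / (real n * ?L n) \<le> (real n - 1) * ?L n / (real n * ?L n)"
      using * by (rule eventually_mono) (intro divide_right_mono nonneg, blast)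
  qed
  have "(\<lambda>n. sqrt (real n) / ?L n) \<longlonglongrightarrow> 0" using a by real_asymp
  from tendsto_add[OF tendsto_mult[OF mean_gap_first_limit[OF ab] this] T]
  have "(\<lambda>n. mean_gap a b n 1 / sqrt (real n) * (sqrt (real n) / ?L n) + ?T n / (real n * ?L n)) \<longlonglongrightarrow> 1"
    by simp
  moreover have "\<forall>\<^sub>F n in sequentially. mean_gap a b n 1 / sqrt (real n) * (sqrt (real n) / ?L n) + ?T n / (real n * ?L n)
    = (1 / real n) * (\<Sum>k=1..n. \<Sum>i=1..k. mean_gap a b n i) / (real n powr (3/2) * inverse a)"
    using eventually_gt_at_top[of 0]
  proof eventually_elim
    case (elim n)
    have "(\<Sum>k=1..n. \<Sum>i=1..k. mean_gap a b n i) = real n * mean_gap a b n 1 + ?T n"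
      using sum_partial_sums[of "mean_gap a b n" n] elim
        sum_split_first[of n "\<lambda>i. real (Suc n - i) * mean_gap a b n i"]
      by simp
    moreover have "real n \<noteq> 0" "sqrt (real n) \<noteq> 0" "?L n \<noteq> 0" using elim a by auto
    moreover have "real n powr (3/2) * inverse a = ?L n" by (rule divide_inverse[symmetric])
    ultimately show ?case by (simp add: add_divide_distrib distrib_right)
  qed
  ultimately show ?thesis by (rule Lim_transform_eventually)
qed

section \<open>Limits of the queue lengths\<close>

theorem corollary2p8:
  fixes a b :: real
    and \<Omega> :: "nat \<Rightarrow> 'w measure"
    and X :: "nat \<Rightarrow> nat \<Rightarrow> 'w \<Rightarrow> nat"
  assumes "0 < b" and "b < a"
    and "\<And>n. a < real n powr (3/2) \<Longrightarrow> prob_space (\<Omega> n)"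
    and "\<And>n i. a < real n powr (3/2) \<Longrightarrow> i \<in> {1..n} \<Longrightarrow>
           X n i \<in> measurable (\<Omega> n) (count_space UNIV)"
    and "\<And>n. a < real n powr (3/2) \<Longrightarrow>
           distr (\<Omega> n) (lattice_vectors n)
             (\<lambda>\<omega>. \<lambda>k\<in>{1..n}. real (ranked n (\<lambda>i. X n i \<omega>) k) / sqrt (real n))
           = ranked_law a b n"
  shows "(\<forall>k\<ge>1. (\<lambda>n. (\<integral>\<omega>. real (ranked n (\<lambda>i. X n i \<omega>) k) \<partial>\<Omega> n)
              / (sqrt (real n) * (1 / (a - b) + (real k - 1) / a))) \<longlonglongrightarrow> 1)
    \<and> (\<lambda>n. (\<integral>\<omega>. real (ranked n (\<lambda>i. X n i \<omega>) n) - real (ranked n (\<lambda>i. X n i \<omega>) 1) \<partial>\<Omega> n)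
              / (real n powr (3/2) * inverse a * ln (real n))) \<longlonglongrightarrow> 1
    \<and> (\<lambda>n. (\<integral>\<omega>. (1 / real n) * (\<Sum>k=1..n. real (ranked n (\<lambda>i. X n i \<omega>) k)) \<partial>\<Omega> n)
              / (real n powr (3/2) * inverse a)) \<longlonglongrightarrow> 1"
proof (intro conjI allI impI)
  have a: "0 < a" using assms(1,2) by simp
  have expect: "has_bochner_integral (\<Omega> n) (\<lambda>\<omega>. real (ranked n (\<lambda>i. X n i \<omega>) k))
      (\<Sum>i=1..k. mean_gap a b n i)" if "a < real n powr (3/2)" "k \<in> {1..n}" for n k
    using ranked_expectation[OF assms(1,2) that(1,2) assms(4,5)[OF that(1)]] .
  {
    fix k :: nat assume k: "1 \<le> k"
    have k_sum: "1 / (a - b) + (real k - 1) / a > 0"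
      using k a assms(2) by (intro add_pos_nonneg) auto
    have "(\<lambda>n. mean_gap a b n 1 / sqrt (real n) + (\<Sum>i=2..k. mean_gap a b n i / sqrt (real n)))
        \<longlonglongrightarrow> 1 / (a - b) + (\<Sum>i=2..k. 1 / a)"
      by (intro tendsto_add tendsto_sum mean_gap_first_limit mean_gap_later_limit assms(1,2) a) auto
    moreover have "(\<Sum>i=2..k. 1 / a) = (real k - 1) / a"
      using k by (cases "k = 1") (auto simp: of_nat_diff)
    ultimately have "(\<lambda>n. (mean_gap a b n 1 / sqrt (real n) + (\<Sum>i=2..k. mean_gap a b n i / sqrt (real n)))
         / (1 / (a - b) + (real k - 1) / a)) \<longlonglongrightarrow> 1"
      using k_sum by (auto dest: tendsto_divide[OF _ tendsto_const[of "1 / (a - b) + (real k - 1) / a"]])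
    moreover have "\<forall>\<^sub>F n in sequentially.
        (mean_gap a b n 1 / sqrt (real n) + (\<Sum>i=2..k. mean_gap a b n i / sqrt (real n)))
           / (1 / (a - b) + (real k - 1) / a)
        = (\<integral>\<omega>. real (ranked n (\<lambda>i. X n i \<omega>) k) \<partial>\<Omega> n)
              / (sqrt (real n) * (1 / (a - b) + (real k - 1) / a))"
      using eventually_less_powr_three_halves[of a] eventually_ge_at_top[of k]
    proof eventually_elim
      case (elim n)
      have "(\<integral>\<omega>. real (ranked n (\<lambda>i. X n i \<omega>) k) \<partial>\<Omega> n) = (\<Sum>i=1..k. mean_gap a b n i)"
        using elim k by (intro has_bochner_integral_integral_eq expect) auto
      also have "\<dots> = mean_gap a b n 1 + (\<Sum>i=2..k. mean_gap a b n i)"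
        using k by (rule sum_split_first)
      finally show ?case
        by (simp add: sum_divide_distrib[symmetric] add_divide_distrib[symmetric])
    qed
    ultimately show "(\<lambda>n. (\<integral>\<omega>. real (ranked n (\<lambda>i. X n i \<omega>) k) \<partial>\<Omega> n)
              / (sqrt (real n) * (1 / (a - b) + (real k - 1) / a))) \<longlonglongrightarrow> 1"
      by (rule Lim_transform_eventually)
  }
  have "\<forall>\<^sub>F n in sequentially.
      (\<Sum>i=2..n. mean_gap a b n i)
        = (\<integral>\<omega>. real (ranked n (\<lambda>i. X n i \<omega>) n) - real (ranked n (\<lambda>i. X n i \<omega>) 1) \<partial>\<Omega> n)"
    using eventually_less_powr_three_halves[of a] eventually_ge_at_top[of 1]
  proof eventually_elim
    case (elim n)
    then have "(\<integral>\<omega>. real (ranked n (\<lambda>i. X n i \<omega>) n) - real (ranked n (\<lambda>i. X n i \<omega>) 1) \<partial>\<Omega> n)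
        = (\<Sum>i=1..n. mean_gap a b n i) - (\<Sum>i=1..1. mean_gap a b n i)"
      by (intro has_bochner_integral_integral_eq has_bochner_integral_diff expect) auto
    also have "(\<Sum>i=1..n. mean_gap a b n i) = mean_gap a b n 1 + (\<Sum>i=2..n. mean_gap a b n i)"
      using elim(2) by (rule sum_split_first)
    finally show ?case by simp
  qed
  then show "(\<lambda>n. (\<integral>\<omega>. real (ranked n (\<lambda>i. X n i \<omega>) n) - real (ranked n (\<lambda>i. X n i \<omega>) 1) \<partial>\<Omega> n)
              / (real n powr (3/2) * inverse a * ln (real n))) \<longlonglongrightarrow> 1"
    by (rule Lim_transform_eventually[OF sum_mean_gap_limit[OF a, of b], OF eventually_mono]) (simp only:)
  have "\<forall>\<^sub>F n in sequentially.
      (1 / real n) * (\<Sum>k=1..n. \<Sum>i=1..k. mean_gap a b n i)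
        = (\<integral>\<omega>. (1 / real n) * (\<Sum>k=1..n. real (ranked n (\<lambda>i. X n i \<omega>) k)) \<partial>\<Omega> n)"
    using eventually_less_powr_three_halves[of a]
  proof eventually_elim
    case (elim n)
    then show ?case
      by (intro has_bochner_integral_integral_eq[symmetric] has_bochner_integral_mult_right
            has_bochner_integral_sum expect)
  qed
  then show "(\<lambda>n. (\<integral>\<omega>. (1 / real n) * (\<Sum>k=1..n. real (ranked n (\<lambda>i. X n i \<omega>) k)) \<partial>\<Omega> n)
              / (real n powr (3/2) * inverse a)) \<longlonglongrightarrow> 1"
    by (rule Lim_transform_eventually[OF average_mean_gap_limit[OF assms(1,2)], OF eventually_mono]) (simp only:)
qed

end
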